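(* For every odd integer $n\ge 3$, the cycle $C_n$ on $n$ vertices satisfies \[ \underline{\mathrm{scs}}(C_n)=\frac{n+1}{2}. \]
   Context: $[k]=\{1,\dots,k\}$ and $\chi(G)$ is the chromatic number of a graph $G=(V,E)$. For a proper coloring $c:V\to[\chi(G)]$, a determining set for $(G,c)$ is a set $S\subseteq V$ such that for every proper coloring $c':V\to[\chi(G)]$ of $G$, if $c'|_S=c|_S$ then $c'=c$ on all of $V$. A critical set for $(G,c)$ is a determining set for $(G,c)$ that is minimal under inclusion. Define $\mathrm{scs}(G,c)=\min\{|X| : X \text{ is a critical set for } (G,c)\}$ and $\underline{\mathrm{scs}}(G)=\min_c \mathrm{scs}(G,c)$, where the minimum is over all proper colorings $c:V\to[\chi(G)]$. *)

theory Defs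
  imports Complex_Main "HOL-Library.FuncSet"
begin

record 'a graph =
  verts :: "'a set"
  edges :: "'a set set"

definition finite_simple_graph :: "'a graph \<Rightarrow> bool" where
  "finite_simple_graph G \<longleftrightarrow>
     finite (verts G) \<and> (\<forall>e\<in>edges G. e \<subseteq> verts G \<and> card e = 2)"

text \<open>Colorings are taken in the extensional function space, so that equality of two colorings
  means agreement on all vertices, and a finite graph has only finitely many of them.\<close>

definition proper_colorings :: "'a graph \<Rightarrow> nat \<Rightarrow> ('a \<Rightarrow> nat) set" where
  "proper_colorings G k =
     {c \<in> verts G \<rightarrow>\<^sub>E {1..k}. \<forall>u v. {u, v} \<in> edges G \<longrightarrow> c u \<noteq> c v}"

definition chromatic_number :: "'a graph \<Rightarrow> nat" where
  "chromatic_number G = (LEAST k. proper_colorings G k \<noteq> {})"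

definition determining_set :: "'a graph \<Rightarrow> ('a \<Rightarrow> nat) \<Rightarrow> 'a set \<Rightarrow> bool" where
  "determining_set G c S \<longleftrightarrow>
     S \<subseteq> verts G \<and>
     (\<forall>c'\<in>proper_colorings G (chromatic_number G). (\<forall>v\<in>S. c' v = c v) \<longrightarrow> c' = c)"

definition critical_set :: "'a graph \<Rightarrow> ('a \<Rightarrow> nat) \<Rightarrow> 'a set \<Rightarrow> bool" where
  "critical_set G c S \<longleftrightarrow>
     determining_set G c S \<and> (\<forall>T. T \<subset> S \<longrightarrow> \<not> determining_set G c T)"

definition scs :: "'a graph \<Rightarrow> ('a \<Rightarrow> nat) \<Rightarrow> nat" where
  "scs G c = Min {card X | X. critical_set G c X}"

definition min_scs :: "'a graph \<Rightarrow> nat" where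
  "min_scs G = Min {scs G c | c. c \<in> proper_colorings G (chromatic_number G)}"

text \<open>For \<open>n \<ge> 3\<close> this is the cycle on \<open>n\<close> vertices; smaller \<open>n\<close> give degenerate edges.\<close>

definition cycle_graph :: "nat \<Rightarrow> nat graph" where
  "cycle_graph n = \<lparr>verts = {0..<n}, edges = {{i, Suc i mod n} | i. i < n}\<rparr>"

lemma finite_simple_graph_cycle_graph:
  assumes "n \<ge> 3"
  shows "finite_simple_graph (cycle_graph n)"
proof -
  have "card {i, Suc i mod n} = 2" if "i < n" for i
  proof -
    have "i \<noteq> Suc i mod n"
      using that assms by (cases "Suc i = n") auto
    then show ?thesis by simp
  qed
  then show ?thesis
    using assms by (auto simp: finite_simple_graph_def cycle_graph_def)
qed

text \<open>For finite simple graphs the \<open>LEAST\<close> and \<open>Min\<close> above are attained.\<close>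

lemma finite_proper_colorings:
  assumes "finite_simple_graph G"
  shows "finite (proper_colorings G k)"
proof (rule finite_subset)
  show "proper_colorings G k \<subseteq> verts G \<rightarrow>\<^sub>E {1..k}"
    by (auto simp: proper_colorings_def)
  show "finite (verts G \<rightarrow>\<^sub>E {1..k})"
    using assms by (auto simp: finite_simple_graph_def intro!: finite_PiE)
qed

lemma proper_colorings_chromatic_number_nonempty:
  assumes "finite_simple_graph G"
  shows "proper_colorings G (chromatic_number G) \<noteq> {}"
proof -
  have fin: "finite (verts G)"
    using assms by (simp add: finite_simple_graph_def)
  obtain f where f: "bij_betw f (verts G) {1..card (verts G)}"
    using ex_bij_betw_finite_nat[OF fin] fin
    by (metis card_atLeastAtMost diff_Suc_1 finite_atLeastAtMost finite_same_card_bij)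
  have ne: "f u \<noteq> f v" and mem: "u \<in> verts G" "v \<in> verts G" if "{u, v} \<in> edges G" for u v
  proof -
    have uv: "{u, v} \<subseteq> verts G" "card {u, v} = 2"
      using assms that by (auto simp: finite_simple_graph_def)
    then have "u \<noteq> v" by auto
    then show "f u \<noteq> f v" "u \<in> verts G" "v \<in> verts G"
      using f uv by (auto simp: bij_betw_def inj_on_def)
  qed
  have "restrict f (verts G) \<in> proper_colorings G (card (verts G))"
    using f ne mem unfolding proper_colorings_def bij_betw_def by (auto simp del: atLeastAtMost_iff)
  then show ?thesis
    unfolding chromatic_number_def by (intro LeastI_ex[where P = "\<lambda>k. proper_colorings G k \<noteq> {}"]) blast
qed

lemma finite_critical_sets:
  assumes "finite_simple_graph G"
  shows "finite {X. critical_set G c X}"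
  using assms
  by (auto simp: finite_simple_graph_def critical_set_def determining_set_def
      intro: finite_subset[of _ "Pow (verts G)"])

lemma critical_set_exists:
  assumes "finite_simple_graph G" "c \<in> proper_colorings G (chromatic_number G)"
  shows "\<exists>X. critical_set G c X"
proof -
  have "determining_set G c (verts G)"
    using assms(2) by (auto simp: determining_set_def proper_colorings_def intro: PiE_ext)
  moreover have "finite {X. determining_set G c X}"
    using assms(1)
    by (auto simp: finite_simple_graph_def determining_set_def
        intro: finite_subset[of _ "Pow (verts G)"])
  ultimately obtain X where "determining_set G c X"
      "\<forall>T. determining_set G c T \<longrightarrow> T \<subseteq> X \<longrightarrow> X = T"
    using finite_has_minimal[of "{X. determining_set G c X}"] by auto
  then show ?thesis
    unfolding critical_set_def by blast
qed

end

(* In a proper 3-coloring of a cycle, two adjacent vertices u, v can never both be left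
   undetermined: if the outer neighbor of one of them has the color of the other one, the former
   has a spare color, and if not, swapping the colors of u and v keeps the coloring proper.
   Hence determining sets are vertex covers, which for odd n have at least (n+1)/2 elements.
   Conversely, color the even vertices of C_n so that vertices at distance 2 get distinct colors;
   then every odd vertex is forced, and the (n+1)/2 even vertices form a determining set. *)
theory Submission
  imports Defs
begin

section \<open>From \<open>min_scs\<close> to bounds on determining sets\<close>

lemma finite_card_critical_sets:
  assumes "finite_simple_graph G"
  shows "finite {card X | X. critical_set G c X}"
proof -
  have "{card X | X. critical_set G c X} = card ` {X. critical_set G c X}" by auto
  then show ?thesis using finite_critical_sets[OF assms] by simp
qed

text \<open>Critical sets are determining, so a lower bound for determining sets bounds every
  \<open>scs\<close>. A determining set of size \<open>k\<close> attains it and is critical itself,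
  as a proper subset would be smaller than the bound allows.\<close>

lemma min_scs_eqI:
  assumes G: "finite_simple_graph G"
    and lower: "\<And>c S. c \<in> proper_colorings G (chromatic_number G) \<Longrightarrow> determining_set G c S
      \<Longrightarrow> k \<le> card S"
    and c: "c \<in> proper_colorings G (chromatic_number G)"
    and S: "determining_set G c S" "card S = k"
  shows "min_scs G = k"
proof -
  have ge: "k \<le> scs G c'" if c': "c' \<in> proper_colorings G (chromatic_number G)" for c'
  proof -
    have "{card X | X. critical_set G c' X} \<noteq> {}"
      using critical_set_exists[OF G c'] by auto
    then have "scs G c' \<in> {card X | X. critical_set G c' X}"
      unfolding scs_def using Min_in finite_card_critical_sets[OF G] by blast
    then show ?thesis
      using lower[OF c'] by (auto simp: critical_set_def)
  qed
  have "finite S"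
    using S(1) G by (auto simp: determining_set_def finite_simple_graph_def intro: finite_subset)
  then have "critical_set G c S"
    unfolding critical_set_def using S lower[OF c] psubset_card_mono
    by (metis leD)
  then have "scs G c \<le> k"
    unfolding scs_def using S(2) by (intro Min_le finite_card_critical_sets[OF G]) auto
  then have eq: "scs G c = k"
    using ge[OF c] by simp
  have "{scs G c | c. c \<in> proper_colorings G (chromatic_number G)}
      = scs G ` proper_colorings G (chromatic_number G)" by auto
  then have "finite {scs G c | c. c \<in> proper_colorings G (chromatic_number G)}"
    using finite_proper_colorings[OF G] by simp
  then show ?thesis
    unfolding min_scs_def using ge eq c by (intro Min_eqI) auto
qed

section \<open>Colorings of odd cycles with at most two colors\<close>

lemma proper_colorings_cycle_graph:
  "proper_colorings (cycle_graph n) k =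
    {c \<in> {0..<n} \<rightarrow>\<^sub>E {1..k}. \<forall>i<n. c i \<noteq> c (Suc i mod n)}"
proof -
  have "(\<forall>u v. {u, v} \<in> edges (cycle_graph n) \<longrightarrow> c u \<noteq> c v) \<longleftrightarrow>
      (\<forall>i<n. c i \<noteq> c (Suc i mod n))" for c :: "nat \<Rightarrow> nat"
    unfolding cycle_graph_def by (simp add: doubleton_eq_iff) metis
  then show ?thesis by (simp add: proper_colorings_def cycle_graph_def)
qed

lemma cycle_succ_eq_iff:
  fixes i j n :: nat
  assumes "i < n" "j < n"
  shows "Suc i mod n = Suc j mod n \<longleftrightarrow> i = j"
  using assms by (auto simp: mod_Suc split: if_splits)

text \<open>Two colors must alternate from 0 to \<open>n - 1\<close>; as \<open>n - 1\<close> is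
  even, it repeats the color of its neighbor 0.\<close>

lemma odd_cycle_not_2_colorable:
  assumes "odd n" "k \<le> 2"
  shows "proper_colorings (cycle_graph n) k = {}"
proof (rule ccontr)
  assume "proper_colorings (cycle_graph n) k \<noteq> {}"
  then obtain c where "c \<in> proper_colorings (cycle_graph n) k" by blast
  then have range: "c i \<in> {1..k}" and ne: "c i \<noteq> c (Suc i mod n)" if "i < n" for i
    using that by (auto simp: proper_colorings_cycle_graph PiE_iff simp del: atLeastAtMost_iff)
  have alt: "c i = (if even i then c 0 else 3 - c 0)" if "i < n" for i
    using that
  proof (induction i)
    case (Suc i)
    have "c i \<noteq> c (Suc i)" using ne[of i] Suc.prems by simp
    moreover have "c i \<in> {1..k}" "c (Suc i) \<in> {1..k}"
      using range Suc.prems by simp_all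
    ultimately have "c (Suc i) = 3 - c i"
      using assms(2) by auto
    \<comment> \<open>Truncated subtraction then satisfies \<open>3 - (3 - c 0) = c 0\<close>, which
      the odd case needs.\<close>
    moreover have "c 0 \<le> 3"
      using range[of 0] Suc.prems assms(2) by simp
    moreover have "c i = (if even i then c 0 else 3 - c 0)"
      using Suc by simp
    ultimately show ?case by (cases "even i") auto
  qed simp
  have "n > 0" using assms(1) by (cases n) auto
  then have "c (n - 1) = c 0"
    using alt[of "n - 1"] assms(1) by simp
  then show False
    using ne[of "n - 1"] \<open>n > 0\<close> by simp
qed

section \<open>An explicit 3-coloring and its forced vertices\<close>

text \<open>Meant for even \<open>i\<close>: the colors 1, 2 alternate along 0, 2, 4, and so on. For
  odd \<open>n\<close> the last vertex \<open>n - 1\<close> is even and adjacent to 0, so it gets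
  the color 3 used nowhere else here.\<close>

definition even_color :: "nat \<Rightarrow> nat \<Rightarrow> nat" where
  "even_color n i = (if i = n - 1 then 3 else Suc (i div 2 mod 2))"

(* Two distinct colors a, b in {1, 2, 3} leave 6 - a - b as the third one. *)
definition odd_cycle_coloring :: "nat \<Rightarrow> nat \<Rightarrow> nat" where
  "odd_cycle_coloring n = (\<lambda>i\<in>{0..<n}. if even i then even_color n i
     else 6 - even_color n (i - 1) - even_color n (Suc i))"

lemma third_color:
  fixes a b x :: nat
  assumes "a \<in> {1..3}" "b \<in> {1..3}" "a \<noteq> b"
  shows "x \<in> {1..3} \<and> x \<noteq> a \<and> x \<noteq> b \<longleftrightarrow> x = 6 - a - b"
proof -
  have *: "{1..3} = {1, 2, 3::nat}" by auto
  show ?thesis using assms unfolding * by auto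
qed

lemma even_color_range: "even_color n i \<in> {1..3}"
proof -
  have "i div 2 mod 2 < 2" by simp
  then show ?thesis unfolding even_color_def by (auto simp del: mod_less_divisor)
qed

text \<open>Halving consecutive even numbers gives opposite parities; the bound on \<open>i\<close>
  ensures that at most the second of the two vertices has color 3.\<close>

lemma even_color_step: "even i \<Longrightarrow> Suc i < n \<Longrightarrow> even_color n i \<noteq> even_color n (Suc (Suc i))"
proof -
  assume "even i" "Suc i < n"
  then obtain j where "i = 2 * j" by blast
  then show ?thesis
    using \<open>Suc i < n\<close> unfolding even_color_def by (auto simp: mod_Suc)
qed

text \<open>Both directions matter: from right to left the coloring is proper at odd vertices, from
  left to right its values there are forced by the even ones.\<close>

lemma odd_cycle_coloring_forced:
  assumes "odd n" "odd i" "i < n"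
  shows "x \<in> {1..3} \<and> x \<noteq> odd_cycle_coloring n (i - 1) \<and> x \<noteq> odd_cycle_coloring n (Suc i)
    \<longleftrightarrow> x = odd_cycle_coloring n i"
proof -
  \<comment> \<open>With \<open>n\<close> odd, an odd \<open>i\<close> is never the last vertex, so
    neither neighbor wraps around.\<close>
  have *: "even (i - 1)" "even (Suc i)" "Suc i < n" "i > 0" "i - 1 < n"
    using assms by presburger+
  then have "even_color n (i - 1) \<noteq> even_color n (Suc i)"
    using even_color_step[of "i - 1" n] by simp
  from third_color[OF even_color_range even_color_range this, of x]
  show ?thesis using * assms by (simp add: odd_cycle_coloring_def)
qed

lemma odd_cycle_coloring_proper:
  assumes n: "odd n" "n \<ge> 3"
  shows "odd_cycle_coloring n \<in> proper_colorings (cycle_graph n) 3"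
proof -
  let ?c = "odd_cycle_coloring n"
  have "?c i \<in> {1..3}" if "i < n" for i
  proof (cases "even i")
    case True
    then show ?thesis using that even_color_range by (simp add: odd_cycle_coloring_def)
  next
    case False
    then show ?thesis using odd_cycle_coloring_forced[OF n(1) False that] by blast
  qed
  then have range: "?c \<in> {0..<n} \<rightarrow>\<^sub>E {1..3}"
    by (auto simp: odd_cycle_coloring_def)
  have "?c i \<noteq> ?c (Suc i mod n)" if i: "i < n" for i
  proof (cases "i = n - 1")
    \<comment> \<open>The closing edge joins two even vertices, \<open>n - 1\<close> of color 3 and
      0 of color 1. Every other edge has exactly one odd end, where
      \<open>odd_cycle_coloring_forced\<close> applies.\<close>
    case True
    then show ?thesis
      using n by (simp add: odd_cycle_coloring_def even_color_def)
  next
    case False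
    then have si: "Suc i < n" using i by simp
    show ?thesis
    proof (cases "even i")
      case True
      then show ?thesis
        using odd_cycle_coloring_forced[OF n(1) _ si, of "?c (Suc i)"] si by auto
    next
      case False
      then show ?thesis
        using odd_cycle_coloring_forced[OF n(1) False i, of "?c i"] si by auto
    qed
  qed
  then show ?thesis
    using range by (simp add: proper_colorings_cycle_graph)
qed

lemma chromatic_number_odd_cycle:
  assumes "odd n" "n \<ge> 3"
  shows "chromatic_number (cycle_graph n) = 3"
  unfolding chromatic_number_def
proof (rule Least_equality)
  show "proper_colorings (cycle_graph n) 3 \<noteq> {}"
    using odd_cycle_coloring_proper[OF assms] by blast
  show "3 \<le> k" if "proper_colorings (cycle_graph n) k \<noteq> {}" for k
    using odd_cycle_not_2_colorable[OF assms(1), of k] that by linarith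
qed

section \<open>Upper bound from the even vertices\<close>

lemma determining_set_even_vertices:
  assumes n: "odd n" "n \<ge> 3"
  shows "determining_set (cycle_graph n) (odd_cycle_coloring n) {i. i < n \<and> even i}"
  unfolding determining_set_def chromatic_number_odd_cycle[OF n]
proof (intro conjI ballI impI)
  show "{i. i < n \<and> even i} \<subseteq> verts (cycle_graph n)"
    by (auto simp: cycle_graph_def)
  fix c
  assume c: "c \<in> proper_colorings (cycle_graph n) 3"
    and agree: "\<forall>i\<in>{i. i < n \<and> even i}. c i = odd_cycle_coloring n i"
  have range: "c \<in> {0..<n} \<rightarrow>\<^sub>E {1..3}" and ne: "\<And>i. i < n \<Longrightarrow> c i \<noteq> c (Suc i mod n)"
    using c by (auto simp: proper_colorings_cycle_graph)
  have "c i = odd_cycle_coloring n i" if i: "i < n" for i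
  proof (cases "even i")
    case False
    have *: "i > 0" "even (i - 1)" "even (Suc i)" using False by (auto elim: oddE)
    have si: "Suc i < n" "i - 1 < n" using False n(1) i by presburger+
    have "c i \<noteq> c (i - 1)" "c i \<noteq> c (Suc i)"
      using ne[of "i - 1"] ne[of i] * si by auto
    moreover have "c i \<in> {1..3}" using range i by auto
    ultimately show ?thesis
      using odd_cycle_coloring_forced[OF n(1) False i, of "c i"] agree si i * by simp
  qed (use agree i in simp)
  then show "c = odd_cycle_coloring n"
    using range by (intro PiE_ext[of _ "{0..<n}" "\<lambda>_. {1..3}"])
      (use odd_cycle_coloring_proper[OF n] in \<open>auto simp: proper_colorings_cycle_graph\<close>)
qed

lemma card_even_less_odd:
  assumes "odd n"
  shows "card {i. i < n \<and> even i} = Suc n div 2"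
proof -
  have "{i. i < n \<and> even i} = (*) 2 ` {..<Suc n div 2}"
    using assms by (auto elim!: oddE evenE)
  then show ?thesis by (simp add: card_image inj_on_def)
qed

section \<open>Lower bound through vertex covers\<close>

lemma spare_color:
  fixes a b :: nat
  shows "\<exists>x\<in>{1..3}. x \<noteq> a \<and> x \<noteq> b"
proof -
  have "(1 \<noteq> a \<and> 1 \<noteq> b) \<or> (2 \<noteq> a \<and> 2 \<noteq> b) \<or> (3 \<noteq> a \<and> 3 \<noteq> b)" by auto
  then show ?thesis by force
qed

lemma cycle_adjacent_recoloring:
  assumes n: "n \<ge> 3" and c: "c \<in> proper_colorings (cycle_graph n) 3"
    and u: "u < n" and v: "v = Suc u mod n"
  shows "\<exists>c'\<in>proper_colorings (cycle_graph n) 3. c' \<noteq> c \<and> (\<forall>i. i \<noteq> u \<and> i \<noteq> v \<longrightarrow> c' i = c i)"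
proof -
  have range: "c \<in> {0..<n} \<rightarrow>\<^sub>E {1..3}" and ne: "\<And>i. i < n \<Longrightarrow> c i \<noteq> c (Suc i mod n)"
    using c by (auto simp: proper_colorings_cycle_graph)
  note inj = cycle_succ_eq_iff
  have no_loop: "Suc i mod n \<noteq> i" if "i < n" for i
    using that n by (auto simp: mod_Suc)
  have vn: "v < n" using n v by simp
  \<comment> \<open>The vertices \<open>p\<close>, \<open>u\<close>, \<open>v\<close>,
    \<open>w\<close> are consecutive, with \<open>p = w\<close> if \<open>n = 3\<close>. Since
    \<open>w \<noteq> u\<close>, exchanging the colors of \<open>u\<close> and \<open>v\<close>
    leaves that of \<open>w\<close> alone.\<close>
  define w where "w = Suc v mod n"
  have wu: "w \<noteq> u" using u n unfolding w_def v by (auto simp: mod_Suc split: if_splits)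
  obtain p where p: "p < n" "Suc p mod n = u"
  proof
    show "(if u = 0 then n - 1 else u - 1) < n"
      "Suc (if u = 0 then n - 1 else u - 1) mod n = u" using u by auto
  qed
  have cuv: "c u \<noteq> c v" using ne[OF u] v by simp
  \<comment> \<open>If the two neighbors of \<open>z\<close> share a color, only that color and
    \<open>c z\<close> are excluded for a new value at \<open>z\<close>.\<close>
  have recolor: "\<exists>c'\<in>proper_colorings (cycle_graph n) 3.
      c' \<noteq> c \<and> (\<forall>i. i \<noteq> z \<longrightarrow> c' i = c i)"
    if q: "q < n" "z = Suc q mod n" and eq: "c q = c (Suc z mod n)" for q z
  proof -
    have zn: "z < n" using n q by simp
    obtain x where x: "x \<in> {1..3}" "x \<noteq> c z" "x \<noteq> c q" using spare_color by blast
    have "c(z := x) \<in> proper_colorings (cycle_graph n) 3"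
      unfolding proper_colorings_cycle_graph
    proof (intro CollectI conjI allI impI)
      show "c(z := x) \<in> {0..<n} \<rightarrow>\<^sub>E {1..3}"
        using range x zn by (auto simp: PiE_def extensional_def Pi_def)
      show "(c(z := x)) i \<noteq> (c(z := x)) (Suc i mod n)" if "i < n" for i
        using ne[OF that] x q eq no_loop[OF zn] inj[OF that q(1)] by auto
    qed
    moreover have "c(z := x) \<noteq> c" using x by (metis fun_upd_same)
    ultimately show ?thesis by (intro bexI[of _ "c(z := x)"]) auto
  qed
  consider "c p = c v" | "c u = c w" | "c p \<noteq> c v" "c u \<noteq> c w" by blast
  then show ?thesis
  proof cases
    case 1
    then show ?thesis using recolor[of p u] p v by blast
  next
    case 2
    then show ?thesis using recolor[of u v] u v w_def by blast
  next
    case 3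
    \<comment> \<open>The swap keeps the edge from \<open>u\<close> to \<open>v\<close> bichromatic;
      the case assumptions are what the edges from \<open>p\<close> to \<open>u\<close> and from
      \<open>v\<close> to \<open>w\<close> require.\<close>
    let ?c = "c(u := c v, v := c u)"
    have uv: "u \<noteq> v" using no_loop[OF u] v by simp
    have "?c \<in> proper_colorings (cycle_graph n) 3"
      unfolding proper_colorings_cycle_graph
    proof (intro CollectI conjI allI impI)
      show "?c \<in> {0..<n} \<rightarrow>\<^sub>E {1..3}"
        using range u vn by (auto simp: PiE_def extensional_def Pi_def)
      show "?c i \<noteq> ?c (Suc i mod n)" if i: "i < n" for i
      proof -
        consider "i = u" | "i = v" | "i \<noteq> u" "i \<noteq> v" "Suc i mod n = u"
          | "i \<noteq> u" "i \<noteq> v" "Suc i mod n \<noteq> u" by blast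
        then show ?thesis
        proof cases
          case 1
          then show ?thesis using uv cuv v by simp
        next
          case 2
          then show ?thesis using uv 3 wu no_loop[OF vn] w_def by simp
        next
          case a: 3
          then have "i = p" using inj[OF i p(1)] p by simp
          then show ?thesis using a 3 uv by simp
        next
          case 4
          then have "Suc i mod n \<noteq> v" using inj[OF i u] v by simp
          then show ?thesis using 4 ne[OF i] by simp
        qed
      qed
    qed
    moreover have "?c \<noteq> c" using cuv by (metis fun_upd_same)
    ultimately show ?thesis by (intro bexI[of _ ?c]) auto
  qed
qed

text \<open>The predecessors \<open>?T\<close> of \<open>S\<close> are at most as many as
  \<open>S\<close>, since the successor map is injective, and a cover makes \<open>S\<close> and
  \<open>?T\<close> together exhaust the cycle.\<close>

lemma cycle_vertex_cover_card:
  assumes "S \<subseteq> {0..<n}" and cover: "\<And>i. i < n \<Longrightarrow> i \<in> S \<or> Suc i mod n \<in> S"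
  shows "n \<le> 2 * card S"
proof -
  let ?T = "{i \<in> {0..<n}. Suc i mod n \<in> S}"
  have fin: "finite S" using assms(1) finite_subset by blast
  have "card ?T \<le> card S"
    by (rule card_inj_on_le[where f = "\<lambda>i. Suc i mod n"])
      (auto simp: inj_on_def cycle_succ_eq_iff fin)
  moreover have "card {0..<n} \<le> card (S \<union> ?T)"
    using cover fin by (intro card_mono subsetI) (simp, force)
  moreover have "card (S \<union> ?T) \<le> card S + card ?T" by (rule card_Un_le)
  ultimately show ?thesis by simp
qed

lemma determining_set_odd_cycle_card:
  assumes n: "odd n" "n \<ge> 3"
    and c: "c \<in> proper_colorings (cycle_graph n) 3"
    and S: "determining_set (cycle_graph n) c S"
  shows "Suc n div 2 \<le> card S"
proof -
  have "i \<in> S \<or> Suc i mod n \<in> S" if "i < n" for i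
  proof (rule ccontr)
    assume "\<not> ?thesis"
    then show False
      using cycle_adjacent_recoloring[OF n(2) c that refl] S
      unfolding determining_set_def chromatic_number_odd_cycle[OF n] by metis
  qed
  moreover have "S \<subseteq> {0..<n}"
    using S by (simp add: determining_set_def cycle_graph_def)
  ultimately have "n \<le> 2 * card S" by (intro cycle_vertex_cover_card)
  \<comment> \<open>Equality in \<open>n \<le> 2 * card S\<close> is impossible for odd
    \<open>n\<close>, hence the rounding up.\<close>
  then show ?thesis using n(1) by presburger
qed

theorem theorem6:
  fixes n :: nat
  assumes "odd n" and "n \<ge> 3"
  shows "real (min_scs (cycle_graph n)) = (real n + 1) / 2"
proof -
  note chromatic = chromatic_number_odd_cycle[OF assms]
  have "min_scs (cycle_graph n) = Suc n div 2"
  proof (rule min_scs_eqI)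
    show "finite_simple_graph (cycle_graph n)"
      by (rule finite_simple_graph_cycle_graph[OF assms(2)])
    show "odd_cycle_coloring n \<in> proper_colorings (cycle_graph n) (chromatic_number (cycle_graph n))"
      using odd_cycle_coloring_proper[OF assms] by (simp only: chromatic)
    show "Suc n div 2 \<le> card S"
      if "c \<in> proper_colorings (cycle_graph n) (chromatic_number (cycle_graph n))"
        "determining_set (cycle_graph n) c S" for c S
      using determining_set_odd_cycle_card[OF assms] that by (simp only: chromatic)
  qed (use determining_set_even_vertices[OF assms] card_even_less_odd[OF assms(1)] in auto)
  \<comment> \<open>The division in \<open>Suc n div 2\<close> is exact: both sides equal
    \<open>m + 1\<close>.\<close>
  moreover obtain m where "n = 2 * m + 1" using assms(1) by (rule oddE)
  ultimately show ?thesis by simp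
qed

end
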